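(* Let $n>3$ and let $mK_n$ be the mixed complete graph. Then $\det A(mK_n)=0$ if $n$ is even and $\det A(mK_n)=n-2$ if $n$ is odd.
   Context: The directed cycle $dC_n$ has vertices $v_1,\dots,v_n$ and arcs $v_i\to v_{i+1}$ ($1\le i\le n-1$) and $v_n\to v_1$. The mixed complete graph $mK_n$ ($n>3$) is obtained from $dC_n$ by adding both arcs $v_i\to v_j$ and $v_j\to v_i$ for every pair $v_i,v_j$ non-adjacent in the underlying cycle. Its adjacency matrix $A(mK_n)$ has $(i,j)$ entry $1$ if there is an arc $v_i\to v_j$ and $0$ otherwise. *)

theory Defs
  imports "Graph_Theory.Pair_Digraph" "Jordan_Normal_Form.Determinant"
begin

definition directed_cycle :: "nat \<Rightarrow> nat pair_pre_digraph" where
  "directed_cycle n =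
     \<lparr> pverts = {1..n}, parcs = {(i, i + 1) |i. 1 \<le> i \<and> i \<le> n - 1} \<union> {(n, 1)} \<rparr>"

definition mixed_complete_graph :: "nat \<Rightarrow> nat pair_pre_digraph" where
  "mixed_complete_graph n =
     \<lparr> pverts = pverts (directed_cycle n),
       parcs = parcs (directed_cycle n) \<union>
         {(u, v). u \<in> pverts (directed_cycle n) \<and> v \<in> pverts (directed_cycle n) \<and> u \<noteq> v
            \<and> (u, v) \<notin> parcs (directed_cycle n) \<and> (v, u) \<notin> parcs (directed_cycle n)} \<rparr>"

text \<open>Adjacency matrix of a digraph with vertex set \<open>{1..n}\<close>; matrix indices
  start at 0, so the row (column) with index \<open>i\<close> belongs to the vertex \<open>Suc i\<close>.\<close>

definition adjacency_matrix :: "nat pair_pre_digraph \<Rightarrow> real mat" where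
  "adjacency_matrix G =
     mat (card (pverts G)) (card (pverts G))
       (\<lambda>(i, j). if (Suc i, Suc j) \<in> parcs G then 1 else 0)"

end

theory Submission
  imports Defs
begin

text \<open>
  Let \<open>B\<close> be the sum of the identity and the permutation matrix of the reversed cycle. The
  non-arcs of the graph are the loops and the reversed cycle arcs, so the adjacency matrix is
  \<open>J - B\<close> with \<open>J\<close> the all-ones matrix. All row sums of \<open>B\<close> are 2, hence \<open>J - B = B (J / 2 - I)\<close>.
  Expanding along the first row gives \<open>det B = 1 - (-1)\<^sup>n\<close>, and the determinant of \<open>c J - I\<close>
  is \<open>(-1)\<^sup>n (1 - c n)\<close>.
\<close>

text \<open>Index \<open>i\<close> stands for vertex \<open>Suc i\<close>. The case
  \<open>i = 0\<close> is separate because truncated subtraction would give 0 instead of wrapping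
  around to vertex \<open>n\<close>.\<close>

definition cyclic_pred :: "nat \<Rightarrow> nat \<Rightarrow> nat" where
  "cyclic_pred n i = (if i = 0 then n - 1 else i - 1)"

text \<open>As a sum of two indicators, not a disjunction, an entry splits by distributivity: a row
  paired with any vector collapses to two terms.\<close>

definition cyclic_bidiagonal :: "nat \<Rightarrow> 'a :: comm_ring_1 mat" where
  "cyclic_bidiagonal n = mat n n (\<lambda>(i, j). of_bool (j = i) + of_bool (j = cyclic_pred n i))"

definition all_ones_minus_id :: "nat \<Rightarrow> 'a :: comm_ring_1 \<Rightarrow> 'a mat" where
  "all_ones_minus_id n c = mat n n (\<lambda>(i, j). c - of_bool (j = i))"

lemma cyclic_pred_less: "i < n \<Longrightarrow> cyclic_pred n i < n"
  by (auto simp: cyclic_pred_def)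

lemma mat_mult_mat:
  "mat n n f * mat n n g = mat n n (\<lambda>(i, j). \<Sum>k<n. f (i, k) * g (k, j))"
  by (intro eq_matI) (auto simp: scalar_prod_def atLeast0LessThan)

text \<open>All column sums equal \<open>of_nat n * c - 1\<close>, so adding every row to the first
  makes that row constant. Subtracting the first column from the others then leaves a lower
  triangular matrix. Nothing is divided, so any commutative ring will do.\<close>

lemma det_all_ones_minus_id:
  fixes c :: "'a :: comm_ring_1"
  assumes "n > 0"
  shows "det (all_ones_minus_id n c) = (of_nat n * c - 1) * (- 1) ^ (n - 1)"
proof -
  \<comment> \<open>\<open>?L\<close> performs the row additions from the left, \<open>?U\<close>
    the column subtractions from the right; both are unitriangular, so the determinant is
    unchanged.\<close>
  let ?L = "mat n n (\<lambda>(i, j). of_bool (j = i) + of_bool (i = 0 \<and> j \<noteq> 0)) :: 'a mat"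
  let ?U = "mat n n (\<lambda>(i, j). of_bool (i = j) - of_bool (i = 0 \<and> j \<noteq> 0)) :: 'a mat"
  let ?M = "all_ones_minus_id n c"
  let ?N = "mat n n (\<lambda>(i, j). if i = 0 then of_nat n * c - 1 else c - of_bool (j = i))"
  let ?T = "mat n n (\<lambda>(i, j). if i = 0 then if j = 0 then of_nat n * c - 1 else 0
      else if j = 0 then c else - of_bool (j = i))"
  have L_entry: "(\<Sum>k<n. (of_bool (k = i) + of_bool (i = 0 \<and> k \<noteq> 0)) * (c - of_bool (j = k))) =
      (if i = 0 then of_nat n * c - 1 else c - of_bool (j = i))"
    if ij: "i < n" "j < n" for i j
  proof (cases "i = 0")
    case True
    have "(\<Sum>k<n. (of_bool (k = 0) + of_bool (k \<noteq> 0)) * (c - of_bool (j = k))) =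
        (\<Sum>k<n. c - of_bool (j = k))"
      by (intro sum.cong) auto
    then show ?thesis
      using True ij by (simp add: sum_subtractf of_bool_def)
  next
    case False
    then show ?thesis
      using ij by (simp add: of_bool_def if_distrib[of "\<lambda>x. x * _"] cong: if_cong)
  qed
  have L: "?L * ?M = ?N"
    unfolding all_ones_minus_id_def mat_mult_mat
    by (rule cong_mat[OF refl refl]) (simp only: prod.case L_entry)
  have U_entry: "(\<Sum>k<n. f k * (of_bool (k = j) - of_bool (k = 0 \<and> j \<noteq> 0))) =
      f j - of_bool (j \<noteq> 0) * f 0" if "j < n" for j and f :: "nat \<Rightarrow> 'a"
    using that by (cases "j = 0")
      (simp_all add: right_diff_distrib sum_subtractf of_bool_def
        if_distrib[of "\<lambda>x. _ * x"] cong: if_cong)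
  have U: "?N * ?U = ?T"
    unfolding mat_mult_mat
    by (rule cong_mat[OF refl refl]) (simp only: prod.case U_entry, auto)
  have carrier: "?L \<in> carrier_mat n n" "?U \<in> carrier_mat n n" "?M \<in> carrier_mat n n"
    by (auto simp: all_ones_minus_id_def)
  have "det ?L = 1"
    by (subst det_upper_triangular[OF _ carrier(1)])
      (auto simp: prod_list_diag_prod intro!: prod.neutral)
  moreover have "det ?U = 1"
    by (subst det_upper_triangular[OF _ carrier(2)])
      (auto simp: prod_list_diag_prod intro!: prod.neutral)
  moreover have "det (?L * ?M * ?U) = det ?L * det ?M * det ?U"
    unfolding det_mult[OF mult_carrier_mat[OF carrier(1,3)] carrier(2)]
      det_mult[OF carrier(1,3)] ..
  moreover have "det ?T = (of_nat n * c - 1) * (- 1) ^ (n - 1)"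
  proof -
    have "det ?T = (\<Prod>i = 0..<n. ?T $$ (i, i))"
      by (subst det_lower_triangular[of n]) (auto simp: prod_list_diag_prod)
    \<comment> \<open>The corner carries the common column sum; the remaining \<open>n - 1\<close>
      diagonal entries are all -1.\<close>
    also have "\<dots> = ?T $$ (0, 0) * (\<Prod>i = Suc 0..<n. ?T $$ (i, i))"
      using assms by (rule prod.atLeast_Suc_lessThan)
    also have "(\<Prod>i = Suc 0..<n. ?T $$ (i, i)) = (\<Prod>i = Suc 0..<n. - 1)"
      by (intro prod.cong) auto
    finally show ?thesis using assms by simp
  qed
  ultimately show ?thesis unfolding L U by simp
qed

lemma det_cyclic_bidiagonal:
  assumes "n > 1"
  shows "det (cyclic_bidiagonal n :: 'a :: comm_ring_1 mat) = 1 - (- 1) ^ n"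
proof -
  let ?B = "cyclic_bidiagonal n :: 'a mat"
  have B: "?B \<in> carrier_mat n n"
    by (simp add: cyclic_bidiagonal_def)
  have del: "mat_delete ?B 0 j \<in> carrier_mat (n - 1) (n - 1)" for j
    using B by (rule mat_delete_carrier)
  \<comment> \<open>Row 0 is supported on columns 0 and \<open>n - 1\<close>, so only two minors
    matter. In this one the shifted ones lie just below the diagonal.\<close>
  have "det (mat_delete ?B 0 0) = 1"
    by (subst det_lower_triangular[OF _ del])
      (use B in \<open>auto simp: prod_list_diag_prod mat_delete_def cyclic_bidiagonal_def
        cyclic_pred_def intro!: prod.neutral\<close>)
  \<comment> \<open>Here rows move up against the columns: the shifted ones become the diagonal and
    the former diagonal lies just above it.\<close>
  moreover have "det (mat_delete ?B 0 (n - 1)) = 1"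
    by (subst det_upper_triangular[OF _ del])
      (use B in \<open>auto simp: prod_list_diag_prod mat_delete_def cyclic_bidiagonal_def
        cyclic_pred_def intro!: prod.neutral\<close>)
  moreover have "det ?B = (\<Sum>j<n. ?B $$ (0, j) * cofactor ?B 0 j)"
    using laplace_expansion_row[OF B, of 0] assms by simp
  moreover have "\<dots> = (\<Sum>j<n. (of_bool (j = 0) + of_bool (j = n - 1)) * cofactor ?B 0 j)"
    by (intro sum.cong) (auto simp: cyclic_bidiagonal_def cyclic_pred_def)
  moreover have "\<dots> = cofactor ?B 0 0 + cofactor ?B 0 (n - 1)"
    using assms by (simp add: distrib_right sum.distrib of_bool_def
        if_distrib[of "\<lambda>x. x * _"] cong: if_cong)
  \<comment> \<open>The second cofactor has sign \<open>(- 1) ^ (n - 1)\<close>, that is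
    \<open>- ((- 1) ^ n)\<close>.\<close>
  ultimately show ?thesis
    using assms by (cases n) (simp_all add: cofactor_def)
qed

lemma adjacency_matrix_mixed_complete_graph:
  assumes "n > 3"
  shows "adjacency_matrix (mixed_complete_graph n) =
    cyclic_bidiagonal n * all_ones_minus_id n (1 / 2)"
proof -
  have "(\<Sum>k<n. (of_bool (k = i) + of_bool (k = cyclic_pred n i)) * (1 / 2 - of_bool (j = k))) =
      (if (Suc i, Suc j) \<in> parcs (mixed_complete_graph n) then 1 else 0 :: real)"
    if "i < n" "j < n" for i j
  proof -
    \<comment> \<open>The two ones in row \<open>i\<close> each contribute 1/2, which yields the
      all-ones part.\<close>
    have "(\<Sum>k<n. (of_bool (k = i) + of_bool (k = cyclic_pred n i)) * (1 / 2 - of_bool (j = k))) =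
        (1 - of_bool (j = i) - of_bool (j = cyclic_pred n i) :: real)"
      using that cyclic_pred_less[OF that(1)]
      by (simp add: distrib_right sum.distrib of_bool_def
        if_distrib[of "\<lambda>x. x * _"] cong: if_cong)
    moreover have "(Suc i, Suc j) \<in> parcs (mixed_complete_graph n) \<longleftrightarrow>
        j \<noteq> i \<and> j \<noteq> cyclic_pred n i"
      using assms that
      by (auto simp: mixed_complete_graph_def directed_cycle_def cyclic_pred_def)
    \<comment> \<open>The two subtracted indicators are never both 1, so the entry is 0 or
      1.\<close>
    moreover have "cyclic_pred n i \<noteq> i"
      using assms by (auto simp: cyclic_pred_def)
    ultimately show ?thesis by auto
  qed
  moreover have "card (pverts (mixed_complete_graph n)) = n"
    by (simp add: mixed_complete_graph_def directed_cycle_def)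
  ultimately show ?thesis
    unfolding adjacency_matrix_def cyclic_bidiagonal_def all_ones_minus_id_def mat_mult_mat
    by (intro eq_matI) auto
qed

theorem theorem11:
  fixes n :: nat
  assumes "n > 3"
  shows "(even n \<longrightarrow> det (adjacency_matrix (mixed_complete_graph n)) = 0) \<and>
         (odd n \<longrightarrow> det (adjacency_matrix (mixed_complete_graph n)) = real n - 2)"
proof -
  have "det (adjacency_matrix (mixed_complete_graph n)) =
      det (cyclic_bidiagonal n :: real mat) * det (all_ones_minus_id n (1 / 2 :: real))"
    unfolding adjacency_matrix_mixed_complete_graph[OF assms]
    by (rule det_mult) (auto simp: cyclic_bidiagonal_def all_ones_minus_id_def)
  also have "\<dots> = (1 - (- 1) ^ n) * ((real n / 2 - 1) * (- 1) ^ (n - 1))"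
    using assms by (simp add: det_cyclic_bidiagonal det_all_ones_minus_id)
  \<comment> \<open>For even \<open>n\<close> the first factor vanishes; for odd \<open>n\<close> it
    is 2 and the remaining sign is +1.\<close>
  finally show ?thesis
    using assms by (auto simp: algebra_simps)
qed

end
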